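(* Let $D$ be a strongly connected balanced bipartite digraph of order $2a$, where $a\geq 2$. Suppose that for every dominated pair $\{u,v\}$ of vertices in $D$, \[ d(u)+d(v)\geq 3a+1. \] Then $D$ is hamiltonian.
   Context: Digraphs have no loops and no multiple arcs. For a vertex $v$, $d(v)=d^+(v)+d^-(v)$ (out-degree plus in-degree). A pair of distinct vertices $\{u,v\}$ is dominated if there is a vertex $w$ with $wu$ and $wv$ both arcs of $D$. Balanced bipartite: two partite sets of equal size. Hamiltonian: contains a directed cycle through all vertices. *)

theory Defs
  imports "Graph_Theory.Digraph_Component"
begin

definition total_degree :: "('a, 'b) pre_digraph \<Rightarrow> 'a \<Rightarrow> nat" where
  "total_degree D v = out_degree D v + in_degree D v"

definition dominated_pair :: "('a, 'b) pre_digraph \<Rightarrow> 'a \<Rightarrow> 'a \<Rightarrow> bool" where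
  "dominated_pair D u v \<longleftrightarrow>
     u \<noteq> v \<and> (\<exists>w \<in> verts D. w \<rightarrow>\<^bsub>D\<^esub> u \<and> w \<rightarrow>\<^bsub>D\<^esub> v)"

definition bipartition :: "('a, 'b) pre_digraph \<Rightarrow> 'a set \<Rightarrow> 'a set \<Rightarrow> bool" where
  "bipartition D X Y \<longleftrightarrow>
     X \<union> Y = verts D \<and> X \<inter> Y = {} \<and>
     (\<forall>e \<in> arcs D. tail D e \<in> X \<and> head D e \<in> Y \<or> tail D e \<in> Y \<and> head D e \<in> X)"

(* Used for finite digraphs only, where card is the true cardinality. *)
definition balanced_bipartite :: "('a, 'b) pre_digraph \<Rightarrow> bool" where
  "balanced_bipartite D \<longleftrightarrow> (\<exists>X Y. bipartition D X Y \<and> card X = card Y)"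

(* The library's cycle is a nonempty closed directed walk that repeats no vertex except that
   its last vertex is its first one; a pair of opposite arcs u v, v u is a cycle. *)
definition hamiltonian :: "('a, 'b) pre_digraph \<Rightarrow> bool" where
  "hamiltonian D \<longleftrightarrow>
     (\<exists>u p. pre_digraph.cycle D p \<and> pre_digraph.awalk D u p u \<and>
            set (pre_digraph.awalk_verts D u p) = verts D)"

end

theory Submission
  imports Defs "HOL-Combinatorics.Orbits"
begin

text \<open>
  Let \<open>X\<close>, \<open>Y\<close> be the partite sets. If some vertex lies in no dominated pair, then neither does any of
  its in-neighbours, since a vertex of out-degree 1 can only be paired with a vertex adjacent to the
  whole other side. By strong connectivity all out-degrees are then 1, and the digraph is a cycle.
  Otherwise every degree is at least \<open>a + 1\<close>, and Hall's condition gives a cycle factor, that is, a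
  permutation \<open>f\<close> of the vertices along arcs.

  Choose \<open>f\<close> so that no two of its cycles can be merged by exchanging \<open>f u\<close> and \<open>f v\<close>. If there is more
  than one cycle, let \<open>C\<close> be a union of cycles with \<open>m = card (X \<inter> C) \<le> a / 2\<close>. Since merging is
  impossible, at most \<open>2 * m * (a - m)\<close> arcs join \<open>C\<close> to its complement. For \<open>m \<ge> 2\<close> this contradicts
  lower bounds on the degree sums over \<open>X \<inter> C\<close> and \<open>Y \<inter> C\<close>, each compared with the arcs inside \<open>C\<close>
  that enter the respective side. For \<open>m = 1\<close>, all vertices outside \<open>C\<close> turn out to have full degree,
  and the cycles can be merged after all.
\<close>

section \<open>Hall's theorem and cycle factors\<close>

text \<open>Either some proper nonempty \<open>J\<close> is critical, having no more neighbours than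
  elements, and \<open>J\<close> and \<open>I - J\<close> are matched separately; or every such set
  has a surplus, so one pair \<open>x\<close>, \<open>y\<close> can be matched and removed without
  breaking the condition.\<close>

lemma hall_marriage:
  fixes N :: "'i \<Rightarrow> 'b set"
  assumes "finite I" and "\<And>i. i \<in> I \<Longrightarrow> finite (N i)"
    and "\<And>J. J \<subseteq> I \<Longrightarrow> card J \<le> card (\<Union>(N ` J))"
  shows "\<exists>f. inj_on f I \<and> (\<forall>i\<in>I. f i \<in> N i)"
  using assms
proof (induction "card I" arbitrary: I N rule: less_induct)
  case less
  note fin = less.prems(1,2) and hall = less.prems(3)
  show ?case
  proof (cases "\<exists>J. J \<subseteq> I \<and> J \<noteq> {} \<and> J \<noteq> I \<and> card (\<Union>(N ` J)) \<le> card J")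
    case True
    then obtain J where J: "J \<subseteq> I" "J \<noteq> {}" "J \<noteq> I" "card (\<Union>(N ` J)) \<le> card J"
      by blast
    have fJ: "finite J" using J fin finite_subset by blast
    have "\<exists>f. inj_on f J \<and> (\<forall>i\<in>J. f i \<in> N i)"
    proof (rule less.hyps)
      show "card J < card I" using J fin by (simp add: psubset_card_mono psubsetI)
    qed (use J fin fJ hall in auto)
    then obtain f where f: "inj_on f J" "\<forall>i\<in>J. f i \<in> N i" by blast
    define M where "M = (\<lambda>i. N i - \<Union>(N ` J))"
    have "\<exists>g. inj_on g (I - J) \<and> (\<forall>i\<in>I - J. g i \<in> M i)"
    proof (rule less.hyps)
      show "card (I - J) < card I" using J fin by (intro psubset_card_mono) auto
      show "card K \<le> card (\<Union>(M ` K))" if K: "K \<subseteq> I - J" for K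
      proof -
        have fK: "finite K" using K fin finite_subset by blast
        \<comment> \<open>Hall's condition for the union of \<open>K\<close> and \<open>J\<close>,
          less the at most \<open>card J\<close> neighbours of \<open>J\<close>, leaves enough for
          \<open>K\<close>.\<close>
        have "card K + card J = card (K \<union> J)"
          using K fJ fK by (subst card_Un_disjoint) auto
        also have "\<dots> \<le> card (\<Union>(N ` (K \<union> J)))" using K J by (intro hall) auto
        also have "\<Union>(N ` (K \<union> J)) = \<Union>(M ` K) \<union> \<Union>(N ` J)" unfolding M_def by auto
        also have "card \<dots> \<le> card (\<Union>(M ` K)) + card (\<Union>(N ` J))" by (rule card_Un_le)
        finally show ?thesis using J(4) by simp
      qed
    qed (use fin M_def in auto)
    then obtain g where g: "inj_on g (I - J)" "\<forall>i\<in>I - J. g i \<in> M i" by blast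
    define h where "h = (\<lambda>i. if i \<in> J then f i else g i)"
    have "inj_on h I"
    proof (rule inj_onI)
      fix i j assume ij: "i \<in> I" "j \<in> I" "h i = h j"
      show "i = j"
      proof (cases "i \<in> J \<longleftrightarrow> j \<in> J")
        case True
        then show ?thesis using ij f g unfolding h_def inj_on_def by (auto split: if_splits)
      next
        case False
        have ne: "f i' \<noteq> g j'" if "i' \<in> J" "j' \<in> I - J" for i' j'
        proof -
          have "f i' \<in> \<Union>(N ` J)" using f that by blast
          moreover have "g j' \<notin> \<Union>(N ` J)" using g that unfolding M_def by simp
          ultimately show ?thesis by metis
        qed
        have False
        proof (cases "i \<in> J")
          case True
          then show False using ne[of i j] False ij by (simp add: h_def)
        next
          case F: False
          then show False using ne[of j i] False ij by (simp add: h_def)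
        qed
        then show ?thesis ..
      qed
    qed
    moreover have "\<forall>i\<in>I. h i \<in> N i" using f g unfolding h_def M_def by auto
    ultimately show ?thesis by blast
  next
    case False
    then have strict: "card J < card (\<Union>(N ` J))" if "J \<subseteq> I" "J \<noteq> {}" "J \<noteq> I" for J
      using that by (meson not_le)
    show ?thesis
    proof (cases "I = {}")
      case False
      then obtain x where x: "x \<in> I" by blast
      then have "N x \<noteq> {}" using hall[of "{x}"] by auto
      then obtain y where y: "y \<in> N x" by blast
      define M where "M = (\<lambda>i. N i - {y})"
      have "\<exists>g. inj_on g (I - {x}) \<and> (\<forall>i\<in>I - {x}. g i \<in> M i)"
      proof (rule less.hyps)
        show "card (I - {x}) < card I" using x fin by (meson card_Diff1_less)
        show "card K \<le> card (\<Union>(M ` K))" if K: "K \<subseteq> I - {x}" for K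
        proof (cases "K = {}")
          case False
          then have "card K < card (\<Union>(N ` K))" using K x by (intro strict) auto
          moreover have "\<Union>(M ` K) = \<Union>(N ` K) - {y}" unfolding M_def by auto
          moreover have "card (\<Union>(N ` K)) - 1 \<le> card (\<Union>(N ` K) - {y})"
            using diff_card_le_card_Diff[of "{y}"] by simp
          ultimately show ?thesis by simp
        qed simp
      qed (use fin M_def in auto)
      then obtain g where g: "inj_on g (I - {x})" "\<forall>i\<in>I - {x}. g i \<in> M i" by blast
      have "inj_on (g(x := y)) I"
        using g unfolding M_def inj_on_def by auto
      moreover have "\<forall>i\<in>I. (g(x := y)) i \<in> N i" using g y unfolding M_def by auto
      ultimately show ?thesis by blast
    qed simp
  qed
qed

text \<open>Exchanging the images of \<open>u\<close> and \<open>v\<close> fuses two disjoint cycles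
  into one. Every step of \<open>f\<close> is then a walk along \<open>g\<close>, so no old orbit
  breaks apart.\<close>

lemma orbit_comp_transpose:
  assumes f: "f permutes V" "finite V" and uv: "v \<notin> orbit f u"
  defines "g \<equiv> f \<circ> Transposition.transpose u v"
  shows "v \<in> orbit g u"
    and "y \<in> orbit f x \<Longrightarrow> y \<in> orbit g x"
proof -
  have perm: "permutation f" using f permutation_permutes by blast
  \<comment> \<open>\<open>orbit\<close> holds only positive iterates; that \<open>z\<close> returns
    to itself needs a permutation of finite support.\<close>
  have self: "z \<in> orbit f z" for z by (rule permutation_self_in_orbit[OF perm])
  have vu: "u \<notin> orbit f v" using uv orbit_swap[OF self] by blast
  have ne: "u \<noteq> v" using uv self by blast
  \<comment> \<open>From \<open>s\<close> the new map jumps to \<open>f t\<close> and follows the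
    old cycle of \<open>t\<close>, undisturbed because that cycle avoids \<open>s\<close>, up to
    \<open>t\<close>.\<close>
  have merge: "t \<in> orbit (f \<circ> Transposition.transpose s t) s" if "s \<notin> orbit f t" "s \<noteq> t" for s t
  proof -
    let ?h = "f \<circ> Transposition.transpose s t"
    have hs: "f t \<in> orbit ?h s" using orbit.base[of ?h s] by simp
    have "y \<in> orbit ?h s" if "y \<in> orbit f t" for y
      using that
    proof induction
      case (step y)
      show ?case
      proof (cases "y = t")
        case False
        moreover have "y \<noteq> s" using step \<open>s \<notin> orbit f t\<close> by blast
        ultimately have "?h y = f y" by simp
        then show ?thesis using orbit.step[OF step.IH] by metis
      qed (use hs in \<open>simp only:\<close>)
    qed (rule hs)
    then show ?thesis using self by blast
  qed
  show vg: "v \<in> orbit g u" unfolding g_def using merge vu ne by blast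
  have ug: "u \<in> orbit g v"
    unfolding g_def using merge[OF uv] ne by (subst transpose_commute) blast
  have fg: "f z \<in> orbit g z" for z
  proof -
    consider "z = u" | "z = v" | "z \<noteq> u" "z \<noteq> v" by blast
    then show ?thesis
    proof cases
      case 1
      have "g v = f u" by (simp add: g_def)
      then show ?thesis using orbit.step[OF vg] 1 by simp
    next
      case 2
      have "g u = f v" by (simp add: g_def)
      then show ?thesis using orbit.step[OF ug] 2 by simp
    next
      case 3
      then have "g z = f z" by (simp add: g_def)
      then show ?thesis using orbit.base[of g z] by simp
    qed
  qed
  show "y \<in> orbit g x" if "y \<in> orbit f x"
    using that by induction (auto intro: fg orbit_trans)
qed

definition cycle_factor :: "('v \<Rightarrow> 'v \<Rightarrow> bool) \<Rightarrow> 'v set \<Rightarrow> ('v \<Rightarrow> 'v) \<Rightarrow> bool" where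
  "cycle_factor E V f \<longleftrightarrow> f permutes V \<and> (\<forall>v\<in>V. E v (f v))"

text \<open>Take \<open>f\<close> with the most pairs of vertices in a common orbit. A possible
  exchange between different orbits would give a cycle factor whose orbit relation \<open>R\<close>
  is strictly larger.\<close>

lemma cycle_factor_unmergeable:
  assumes "finite V" and "cycle_factor E V f0"
  obtains f where "cycle_factor E V f"
    and "\<And>u v. u \<in> V \<Longrightarrow> v \<in> V \<Longrightarrow> v \<notin> orbit f u \<Longrightarrow> \<not> (E u (f v) \<and> E v (f u))"
proof -
  define R where "R f = {(x, y). x \<in> V \<and> y \<in> V \<and> y \<in> orbit f x}" for f :: "'a \<Rightarrow> 'a"
  have sub: "R f \<subseteq> V \<times> V" for f unfolding R_def by auto
  then have finR: "finite (R f)" for f using assms(1) finite_subset by blast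
  have "card (R f) < Suc (card (V \<times> V))" for f
    unfolding less_Suc_eq_le by (rule card_mono[OF _ sub]) (simp add: assms(1))
  then obtain f where f: "cycle_factor E V f"
    and max: "\<And>g. cycle_factor E V g \<Longrightarrow> card (R g) \<le> card (R f)"
    using ex_has_greatest_nat[of "cycle_factor E V" f0 "\<lambda>f. card (R f)" "Suc (card (V \<times> V))"] assms(2)
    by (metis less_imp_le)
  show ?thesis
  proof (rule that[OF f])
    fix u v assume uv: "u \<in> V" "v \<in> V" "v \<notin> orbit f u"
    show "\<not> (E u (f v) \<and> E v (f u))"
    proof
      assume E: "E u (f v) \<and> E v (f u)"
      let ?g = "f \<circ> Transposition.transpose u v"
      have perm: "f permutes V" using f by (simp add: cycle_factor_def)
      have "?g permutes V"
        using permutes_compose[OF permutes_swap_id[OF uv(1,2)] perm] .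
      moreover have "E w (?g w)" if "w \<in> V" for w
        using that f E unfolding cycle_factor_def Transposition.transpose_def by auto
      ultimately have "cycle_factor E V ?g" by (simp add: cycle_factor_def)
      then have "card (R ?g) \<le> card (R f)" by (rule max)
      moreover have "R f \<subset> R ?g"
      proof
        show "R f \<subseteq> R ?g"
          using orbit_comp_transpose(2)[OF perm assms(1) uv(3)] unfolding R_def by blast
        have "(u, v) \<in> R ?g" "(u, v) \<notin> R f"
          using orbit_comp_transpose(1)[OF perm assms(1) uv(3)] uv unfolding R_def by blast+
        then show "R f \<noteq> R ?g" by metis
      qed
      ultimately show False using psubset_card_mono[OF finR] by (meson not_le)
    qed
  qed
qed

section \<open>Bipartite relations with large degree sums on dominated pairs\<close>

text \<open>Neighbours are counted in the adjacency relation; \<open>total_degree_eq\<close>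
  identifies this with the degree counted by arcs.\<close>

definition degree :: "('v \<Rightarrow> 'v \<Rightarrow> bool) \<Rightarrow> 'v \<Rightarrow> nat" where
  "degree E v = card {w. E v w} + card {w. E w v}"

locale dominated_bipartite =
  fixes X Y :: "'v set" and E :: "'v \<Rightarrow> 'v \<Rightarrow> bool" and a :: nat
  assumes finX: "finite X" and finY: "finite Y" and disj: "X \<inter> Y = {}"
    and cardX: "card X = a" and cardY: "card Y = a" and a_ge: "2 \<le> a"
    and sides: "E u v \<Longrightarrow> u \<in> X \<and> v \<in> Y \<or> u \<in> Y \<and> v \<in> X"
    and strong: "u \<in> X \<union> Y \<Longrightarrow> v \<in> X \<union> Y \<Longrightarrow> E\<^sup>*\<^sup>* u v"
    and degree_sum: "E w u \<Longrightarrow> E w v \<Longrightarrow> u \<noteq> v \<Longrightarrow> 3 * a + 1 \<le> degree E u + degree E v"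
begin

text \<open>Lets every statement proved for \<open>X\<close> be reused for \<open>Y\<close>.\<close>

lemma swap: "dominated_bipartite Y X E a"
proof
  show "E u v \<Longrightarrow> u \<in> Y \<and> v \<in> X \<or> u \<in> X \<and> v \<in> Y" for u v using sides[of u v] by blast
  show "u \<in> Y \<union> X \<Longrightarrow> v \<in> Y \<union> X \<Longrightarrow> E\<^sup>*\<^sup>* u v" for u v
    using strong[of u v] by blast
qed (fact finX finY cardX cardY a_ge degree_sum | use disj in blast)+

lemma out_subset: "x \<in> X \<Longrightarrow> {w. E x w} \<subseteq> Y" and in_subset: "x \<in> X \<Longrightarrow> {w. E w x} \<subseteq> Y"
  using sides disj by blast+

lemma finite_nbrs: "finite {w. E v w}" "finite {w. E w v}"
proof -
  have "{w. E v w} \<subseteq> X \<union> Y" "{w. E w v} \<subseteq> X \<union> Y" using sides by blast+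
  then show "finite {w. E v w}" "finite {w. E w v}" using finX finY finite_subset by blast+
qed

lemma out_le': "x \<in> X \<Longrightarrow> card {w. E x w} \<le> a" and in_le': "x \<in> X \<Longrightarrow> card {w. E w x} \<le> a"
  using card_mono[OF finY out_subset] card_mono[OF finY in_subset] cardY by auto

interpretation sw: dominated_bipartite Y X E a by (rule swap)

lemma out_le: "card {w. E v w} \<le> a" and in_le: "card {w. E w v} \<le> a"
proof -
  show "card {w. E v w} \<le> a"
  proof (cases "v \<in> X \<union> Y")
    case False
    then have "{w. E v w} = {}" using sides by blast
    then show ?thesis by simp
  qed (use out_le' sw.out_le' in blast)
  show "card {w. E w v} \<le> a"
  proof (cases "v \<in> X \<union> Y")
    case False
    then have "{w. E w v} = {}" using sides by blast
    then show ?thesis by simp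
  qed (use in_le' sw.in_le' in blast)
qed

lemma other_vertex:
  obtains u where "u \<in> X \<union> Y" "u \<noteq> v"
proof -
  obtain x y where "x \<in> X" "y \<in> Y"
    using cardX cardY a_ge by (metis card.empty ex_in_conv not_numeral_le_zero)
  then show ?thesis using that[of x] that[of y] disj by blast
qed

lemma ex_out: assumes "v \<in> X \<union> Y" shows "\<exists>w. E v w"
proof -
  obtain u where "u \<in> X \<union> Y" "u \<noteq> v" by (rule other_vertex)
  then show ?thesis using strong[OF assms, of u] by (auto elim: converse_rtranclpE)
qed

lemma ex_in: assumes "v \<in> X \<union> Y" shows "\<exists>w. E w v"
proof -
  obtain u where "u \<in> X \<union> Y" "u \<noteq> v" by (rule other_vertex)
  then show ?thesis using strong[OF _ assms, of u] by (auto elim: rtranclp.cases)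
qed

lemma finV: "finite (X \<union> Y)" using finX finY by simp

lemma factor_bij:
  assumes f: "cycle_factor E (X \<union> Y) f"
  shows "bij_betw f X Y"
proof -
  have fE: "E v (f v)" if "v \<in> X \<union> Y" for v using f that by (simp add: cycle_factor_def)
  have fY: "f y \<in> X" if "y \<in> Y" for y using sides[OF fE[of y]] disj that by blast
  have fX: "f x \<in> Y" if "x \<in> X" for x using sides[OF fE[of x]] disj that by blast
  have perm: "f permutes (X \<union> Y)" using f by (simp add: cycle_factor_def)
  have "inj f" using perm by (rule permutes_inj)
  then have "inj_on f X" by (rule inj_on_subset) simp
  moreover have "f ` X = Y"
  proof
    show "f ` X \<subseteq> Y" using fX by (rule image_subsetI)
    show "Y \<subseteq> f ` X"
    proof
      fix y assume y: "y \<in> Y"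
      then obtain u where u: "u \<in> X \<union> Y" "y = f u"
        using permutes_image[OF perm] by (metis UnI2 image_iff)
      then have "u \<notin> Y" using fY[of u] y disj by (metis disjoint_iff)
      then show "y \<in> f ` X" using u by simp
    qed
  qed
  ultimately show ?thesis by (rule bij_betw_imageI)
qed

section \<open>Vertices that lie in no dominated pair\<close>

definition lonely :: "'v \<Rightarrow> bool" where
  "lonely v \<longleftrightarrow> (\<forall>w u. E w v \<longrightarrow> E w u \<longrightarrow> u = v)"

text \<open>All in-neighbours of \<open>v\<close> have out-degree 1. So \<open>w\<close> has degree
  at most \<open>a + 1\<close>, and a partner \<open>z\<close> of \<open>w\<close> has degree at
  least \<open>2 * a\<close>. Then \<open>z\<close> dominates the whole opposite side, including
  \<open>v\<close>, although its out-degree would have to be 1.\<close>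

lemma lonely_pred:
  assumes v: "lonely v" and wv: "E w v"
  shows "lonely w"
proof (rule ccontr)
  assume "\<not> lonely w"
  then obtain t z where tz: "E t w" "E t z" "z \<noteq> w" by (auto simp: lonely_def)
  have single: "{u. E w' u} = {v}" if "E w' v" for w' using v that by (auto simp: lonely_def)
  have "3 * a + 1 \<le> degree E w + degree E z" using degree_sum tz by metis
  then have "2 * a \<le> degree E z"
    using single[OF wv] in_le[of w] by (simp add: degree_def)
  then have out: "card {u. E z u} = a"
    using out_le[of z] in_le[of z] by (simp add: degree_def)
  have "E z v"
  proof (cases "w \<in> X")
    case True
    then have "v \<in> Y" "z \<in> X" using wv tz sides disj by blast+
    then have "{u. E z u} = Y" using out cardY finY out_subset by (metis card_subset_eq)
    then show ?thesis using \<open>v \<in> Y\<close> by blast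
  next
    case False
    then have "v \<in> X" "z \<in> Y" using wv tz sides disj by blast+
    then have "{u. E z u} = X" using out cardX finX sw.out_subset by (metis card_subset_eq)
    then show ?thesis using \<open>v \<in> X\<close> by blast
  qed
  then have "card {u. E z u} = 1" using single by simp
  then show False using out a_ge by simp
qed

text \<open>Backwards along paths to \<open>v\<close>, loneliness reaches every vertex.
  Out-neighbours are then unique, so on the vertices \<open>E\<close> is the graph of a function
  \<open>f\<close>, and strong connectivity becomes membership in its orbits.\<close>

lemma lonely_factor:
  assumes v: "v \<in> X \<union> Y" "lonely v"
  shows "\<exists>f. cycle_factor E (X \<union> Y) f \<and> (\<forall>u\<in>X \<union> Y. \<forall>w\<in>X \<union> Y. w \<in> orbit f u)"
proof -
  have all: "lonely u" if "u \<in> X \<union> Y" for u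
    using strong[OF that v(1)]
    by (induction rule: converse_rtranclp_induct) (use v lonely_pred in blast)+
  define f where "f u = (if u \<in> X \<union> Y then SOME w. E u w else u)" for u
  have fE: "E u (f u)" if "u \<in> X \<union> Y" for u
    using that ex_out[OF that] unfolding f_def by (simp add: someI_ex)
  have fu: "w = f u" if "E u w" for u w
  proof -
    have "u \<in> X \<union> Y" "w \<in> X \<union> Y" using sides[OF that] by auto
    then show ?thesis using all[of w] fE[of u] that by (auto simp: lonely_def)
  qed
  have "f ` (X \<union> Y) = X \<union> Y"
  proof
    show "f ` (X \<union> Y) \<subseteq> X \<union> Y" using fE sides by blast
    show "X \<union> Y \<subseteq> f ` (X \<union> Y)"
    proof
      fix u assume "u \<in> X \<union> Y"
      then obtain w where "E w u" using ex_in by blast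
      then show "u \<in> f ` (X \<union> Y)" using fu sides by blast
    qed
  qed
  then have "bij_betw f (X \<union> Y) (X \<union> Y)"
    using finV by (simp add: bij_betw_def eq_card_imp_inj_on)
  then have perm: "f permutes (X \<union> Y)"
    by (rule bij_imp_permutes) (simp add: f_def)
  have "w \<in> orbit f u" if "u \<in> X \<union> Y" "w \<in> X \<union> Y" for u w
    using strong[OF that]
  proof (induction rule: rtranclp_induct)
    case base
    show ?case using perm finV using permutation_permutes permutation_self_in_orbit by metis
  next
    case (step y z)
    then show ?case using fu orbit.step by metis
  qed
  then show ?thesis using perm fE unfolding cycle_factor_def by blast
qed

end

section \<open>Counting arcs between vertex sets\<close>

definition arcs_between :: "('v \<Rightarrow> 'v \<Rightarrow> bool) \<Rightarrow> 'v set \<Rightarrow> 'v set \<Rightarrow> nat" where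
  "arcs_between E A B = (\<Sum>u\<in>A. \<Sum>v\<in>B. of_bool (E u v))"

lemma arcs_between_swap: "arcs_between E A B = (\<Sum>v\<in>B. \<Sum>u\<in>A. of_bool (E u v))"
  unfolding arcs_between_def by (rule sum.swap)

lemma arcs_between_le_card_mult:
  assumes "finite A" "finite B" "card A = m" "card B = n"
  shows "arcs_between E A B \<le> m * n"
proof -
  have "arcs_between E A B \<le> (\<Sum>u\<in>A. \<Sum>v\<in>B. 1)"
    unfolding arcs_between_def by (intro sum_mono) simp
  then show ?thesis using assms by simp
qed

text \<open>Reindexing the indicator sums along \<open>f\<close> pairs the possible arc from
  \<open>u\<close> to \<open>f v\<close> with the one from \<open>v\<close> to \<open>f u\<close>;
  at most one of each such pair is present.\<close>

lemma arcs_between_crossing: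
  assumes fin: "finite A" "finite A'" and f: "bij_betw f A B" "bij_betw f A' B'"
    and cross: "\<And>u v. u \<in> A \<Longrightarrow> v \<in> A' \<Longrightarrow> \<not> (E u (f v) \<and> E v (f u))"
  shows "arcs_between E A B' + arcs_between E A' B \<le> card A * card A'"
proof -
  have "arcs_between E A B' = (\<Sum>u\<in>A. \<Sum>v\<in>A'. of_bool (E u (f v)))"
    unfolding arcs_between_def by (simp only: sum.reindex_bij_betw[OF f(2), symmetric])
  moreover have "arcs_between E A' B = (\<Sum>u\<in>A. \<Sum>v\<in>A'. of_bool (E v (f u)))"
    unfolding arcs_between_swap by (simp only: sum.reindex_bij_betw[OF f(1), symmetric])
  ultimately have "arcs_between E A B' + arcs_between E A' B =
      (\<Sum>u\<in>A. \<Sum>v\<in>A'. of_bool (E u (f v)) + of_bool (E v (f u)))"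
    by (simp only: sum.distrib)
  also have "\<dots> \<le> (\<Sum>u\<in>A. \<Sum>v\<in>A'. 1)"
    using cross by (intro sum_mono) auto
  finally show ?thesis by simp
qed

section \<open>Every vertex in a dominated pair: cycle factors and their merging\<close>

locale dense_dominated_bipartite = dominated_bipartite +
  assumes not_lonely: "v \<in> X \<union> Y \<Longrightarrow> \<not> lonely v"
begin

lemma swap_dense: "dense_dominated_bipartite Y X E a"
proof -
  interpret sw: dominated_bipartite Y X E a by (rule swap)
  show ?thesis using not_lonely by unfold_locales (simp add: lonely_def sw.lonely_def Un_commute)
qed

lemma ex_partner:
  assumes "v \<in> X \<union> Y"
  obtains w u where "E w v" "E w u" "u \<noteq> v" "3 * a + 1 \<le> degree E v + degree E u"
proof -
  obtain w u where "E w v" "E w u" "u \<noteq> v"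
    using not_lonely[OF assms] unfolding lonely_def by blast
  then show ?thesis using that degree_sum[of w v u] by blast
qed

lemma degree_le: "degree E v \<le> 2 * a"
  using out_le[of v] in_le[of v] by (simp add: degree_def)

text \<open>A partner of \<open>v\<close> contributes at most \<open>2 * a\<close> to a sum of at
  least \<open>3 * a + 1\<close>.\<close>

lemma degree_ge:
  assumes "v \<in> X \<union> Y"
  shows "a + 1 \<le> degree E v"
proof -
  obtain u where "3 * a + 1 \<le> degree E v + degree E u" using ex_partner[OF assms] by blast
  then show ?thesis using degree_le[of u] by linarith
qed

lemma full_degree_adjacent:
  assumes "x \<in> X" "2 * a \<le> degree E x" "y \<in> Y"
  shows "E x y" "E y x"
proof -
  have "card {w. E x w} = a" "card {w. E w x} = a"
    using assms(2) out_le[of x] in_le[of x] by (simp_all add: degree_def)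
  then have "{w. E x w} = Y" "{w. E w x} = Y"
    using out_subset[OF assms(1)] in_subset[OF assms(1)] finY cardY by (metis card_subset_eq)+
  then show "E x y" "E y x" using assms(3) by auto
qed

text \<open>
  A deficient \<open>S\<close> leaves more vertices outside the neighbourhood of \<open>S\<close> than there are vertices in
  \<open>X - S\<close> to dominate them. Two of these share an in-neighbour, which makes \<open>S\<close> small; but then two
  vertices of \<open>S\<close> have degree sum at most \<open>3 * a\<close>, so the vertices of \<open>S\<close> have disjoint
  in-neighbourhoods, although each of them has in-degree more than \<open>a / 2\<close>.
\<close>
lemma hall_condition:
  assumes S: "S \<subseteq> X"
  shows "card S \<le> card (\<Union>x\<in>S. {w. E x w})"
proof (rule ccontr)
  define N where "N = (\<Union>x\<in>S. {w. E x w})"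
  assume "\<not> ?thesis"
  then have lt: "card N < card S" by (simp add: N_def)
  have NY: "N \<subseteq> Y" using out_subset S unfolding N_def by blast
  have finS: "finite S" and finN: "finite N" using S NY finX finY finite_subset by blast+
  have "S \<noteq> {}" using lt by auto
  then obtain x0 where "x0 \<in> S" by blast
  then have "N \<noteq> {}" using ex_out[of x0] S unfolding N_def by blast
  then have r1: "1 \<le> card N" using finN by (simp add: Suc_le_eq card_gt_0_iff)
  have SX: "card S \<le> a" using S finX cardX card_mono by blast
  define T where "T = Y - N"
  have cT: "card T = a - card N" unfolding T_def using NY finN cardY by (simp add: card_Diff_subset)
  have cXS: "card (X - S) = a - card S" using S finS cardX by (simp add: card_Diff_subset)
  have inT: "{w. E w t} \<subseteq> X - S" if "t \<in> T" for t
    using that sides disj unfolding T_def N_def by blast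
  have "\<forall>t\<in>T. \<exists>w. E w t" using ex_in unfolding T_def by blast
  then obtain g where g: "\<And>t. t \<in> T \<Longrightarrow> E (g t) t" by metis
  have "g ` T \<subseteq> X - S" using g inT by blast
  then have "card (g ` T) \<le> card (X - S)" using finX by (intro card_mono) auto
  then have "card (g ` T) < card T" using cT cXS lt SX by linarith
  then have "\<not> inj_on g T" using pigeonhole by blast
  then obtain t t' where t: "t \<in> T" "t' \<in> T" "t \<noteq> t'" "g t = g t'" by (auto simp: inj_on_def)
  have dT: "degree E t \<le> a + (a - card S)" if "t \<in> T" for t
    using out_le[of t] card_mono[OF _ inT[OF that]] finX cXS by (simp add: degree_def)
  have "3 * a + 1 \<le> degree E t + degree E t'" using g t degree_sum by metis
  \<comment> \<open>All in-neighbours of a vertex of \<open>T\<close> lie in \<open>X - S\<close>,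
    so the degree sum is at most \<open>4 * a - 2 * card S\<close>.\<close>
  then have s: "2 * card S + 1 \<le> a" using dT[OF t(1)] dT[OF t(2)] SX by linarith
  have "2 \<le> card S" using r1 lt by linarith
  then obtain x x' where x: "x \<in> S" "x' \<in> S" "x \<noteq> x'"
    using finS by (metis card_le_Suc0_iff_eq not_less_eq_eq numeral_2_eq_2)
  have out: "card {w. E x w} \<le> card N" if "x \<in> S" for x
    using that by (intro card_mono finN) (auto simp: N_def)
  have xX: "x \<in> X" "x' \<in> X" using x S by auto
  have "{w. E w x} \<inter> {w. E w x'} = {}"
  proof (rule ccontr)
    assume "\<not> ?thesis"
    then obtain w where "E w x" "E w x'" by blast
    then have "3 * a + 1 \<le> degree E x + degree E x'" using degree_sum x by blast
    then show False
      using out[OF x(1)] out[OF x(2)] in_le[of x] in_le[of x'] lt s by (simp add: degree_def)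
  qed
  then have "card {w. E w x} + card {w. E w x'} = card ({w. E w x} \<union> {w. E w x'})"
    by (simp add: card_Un_disjoint finite_nbrs)
  also have "\<dots> \<le> a" using in_subset[OF xX(1)] in_subset[OF xX(2)] finY cardY card_mono
    by (metis Un_least)
  \<comment> \<open>Both degrees exceed \<open>a\<close> and both out-degrees are below
    \<open>a / 2\<close>, so the two in-degrees sum to more than \<open>a\<close>.\<close>
  finally show False
    using out[OF x(1)] out[OF x(2)] degree_ge[of x] degree_ge[of x'] xX lt s
    by (simp add: degree_def)
qed

lemma ex_matching: "\<exists>g. bij_betw g X Y \<and> (\<forall>x\<in>X. E x (g x))"
proof -
  have "\<exists>g. inj_on g X \<and> (\<forall>x\<in>X. g x \<in> {w. E x w})"
    by (rule hall_marriage[OF finX finite_nbrs(1) hall_condition])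
  then obtain g where g: "inj_on g X" "\<forall>x\<in>X. g x \<in> {w. E x w}" by blast
  have "g ` X \<subseteq> Y" using g out_subset by blast
  then have "g ` X = Y" using card_image[OF g(1)] finY cardX cardY by (simp add: card_subset_eq)
  then show ?thesis using g by (auto simp: bij_betw_def)
qed

text \<open>A matching from \<open>X\<close> to \<open>Y\<close> and one from \<open>Y\<close> to
  \<open>X\<close> together form a permutation along arcs.\<close>

lemma ex_cycle_factor: "\<exists>f. cycle_factor E (X \<union> Y) f"
proof -
  interpret sw: dense_dominated_bipartite Y X E a by (rule swap_dense)
  obtain g h where g: "bij_betw g X Y" "\<And>x. x \<in> X \<Longrightarrow> E x (g x)"
    and h: "bij_betw h Y X" "\<And>y. y \<in> Y \<Longrightarrow> E y (h y)"
    using ex_matching sw.ex_matching by blast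
  define f where "f v = (if v \<in> X then g v else if v \<in> Y then h v else v)" for v
  have "bij_betw f X Y" using g(1) by (rule bij_betw_cong[THEN iffD1, rotated]) (simp add: f_def)
  moreover have "bij_betw f Y X"
    using h(1) by (rule bij_betw_cong[THEN iffD1, rotated]) (use disj in \<open>auto simp: f_def\<close>)
  ultimately have "bij_betw f (X \<union> Y) (Y \<union> X)"
    using disj by (intro bij_betw_combine) auto
  then have "bij_betw f (X \<union> Y) (X \<union> Y)" by (simp add: Un_commute)
  then have "f permutes (X \<union> Y)" by (rule bij_imp_permutes) (simp add: f_def)
  moreover have "E v (f v)" if "v \<in> X \<union> Y" for v
    using that g(2) h(2) by (auto simp: f_def)
  ultimately show ?thesis unfolding cycle_factor_def by blast
qed

text \<open>
  No vertex dominates two of the vertices of degree at most \<open>3 * a / 2\<close> (the set \<open>L\<close> below), so having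
  many of them reduces the number of arcs from \<open>B\<close> to \<open>A\<close> by more than it reduces the degree sum.
\<close>
lemma sum_degree_gt:
  assumes sub: "A \<subseteq> X" "B \<subseteq> Y" and cA: "card A = m" and cB: "card B = m"
    and m: "2 \<le> m" "2 * m \<le> a" and f: "bij_betw f B A" and fE: "\<And>y. y \<in> B \<Longrightarrow> E y (f y)"
  shows "2 * arcs_between E B A + m * (a - m) < (\<Sum>x\<in>A. degree E x)"
proof -
  have finA: "finite A" and finB: "finite B" using sub finX finY finite_subset by blast+
  \<comment> \<open>\<open>b\<close>, and below \<open>c\<close> and \<open>k\<close>, replace
    truncated subtraction, so that each case ends in a polynomial inequality.\<close>
  obtain b where b: "a = 2 * m + b" using m(2) nat_le_iff_add by auto
  define L where "L = {x\<in>A. 2 * degree E x \<le> 3 * a}"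
  have LA: "L \<subseteq> A" and finL: "finite L" using finA by (auto simp: L_def)
  have lm: "card L \<le> m" using card_mono[OF finA LA] cA by simp
  obtain c where c: "m = card L + c" using lm nat_le_iff_add by auto
  have Lone: "card {x\<in>L. E y x} \<le> 1" for y
  proof -
    have "x = x'" if "x \<in> L" "x' \<in> L" "E y x" "E y x'" for x x'
    proof (rule ccontr)
      assume "x \<noteq> x'"
      then have "3 * a + 1 \<le> degree E x + degree E x'" using degree_sum that by blast
      then show False using that by (simp add: L_def)
    qed
    then show ?thesis using finL by (simp add: card_le_Suc0_iff_eq)
  qed
  have ge: "a + 1 \<le> degree E x" if "x \<in> A" for x using degree_ge[of x] sub that by blast
  have split: "(\<Sum>x\<in>A. degree E x) = (\<Sum>x\<in>A - L. degree E x) + (\<Sum>x\<in>L. degree E x)"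
    using LA finA by (simp add: sum.subset_diff)
  have cAL: "card (A - L) = c" using LA finL cA c by (simp add: card_Diff_subset)
  have "(\<Sum>x\<in>A - L. 3 * a + 1) \<le> (\<Sum>x\<in>A - L. 2 * degree E x)"
    by (rule sum_mono) (auto simp: L_def)
  then have high: "c * (3 * a + 1) \<le> 2 * (\<Sum>x\<in>A - L. degree E x)"
    using cAL by (simp add: sum_distrib_left)
  have "(\<Sum>x\<in>L. a + 1) \<le> (\<Sum>x\<in>L. degree E x)"
    by (rule sum_mono) (use ge LA in blast)
  then have low: "card L * (a + 1) \<le> (\<Sum>x\<in>L. degree E x)" by simp
  have arcs_le: "arcs_between E B A \<le> m * m"
    by (rule arcs_between_le_card_mult[OF finB finA cB cA])
  have am: "a - m = m + b" using b by simp
  \<comment> \<open>With average degree at least \<open>(3 * a + 1) / 2\<close>, the trivial bound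
    \<open>m * m\<close> on the arcs from \<open>B\<close> to \<open>A\<close> suffices.\<close>
  have easy: ?thesis if "m * (3 * a + 1) \<le> 2 * (\<Sum>x\<in>A. degree E x)"
  proof -
    have "4 * arcs_between E B A + 2 * (m * (a - m)) < m * (3 * a + 1)"
      using arcs_le m unfolding am b by (simp add: algebra_simps)
    then show ?thesis using that by linarith
  qed
  consider "card L = 0" | "card L = 1" | "2 \<le> card L" by linarith
  then show ?thesis
  proof cases
    case 1
    then show ?thesis using high split c by (intro easy) simp
  next
    case 2
    then obtain x where x: "L = {x}" by (meson card_1_singletonE)
    then have xA: "x \<in> A" using LA by blast
    \<comment> \<open>The matching \<open>f\<close> supplies an in-neighbour \<open>w\<close> of
      \<open>x\<close> inside \<open>B\<close>. If \<open>w\<close> dominates another vertex of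
      \<open>A\<close>, the degree sum of that pair restores the average; otherwise \<open>w\<close>
      sends only one arc to \<open>A\<close>.\<close>
    then obtain w where w: "w \<in> B" "f w = x" using f by (auto simp: bij_betw_def)
    have wx: "E w x" using fE w by blast
    obtain k where k: "m = k + 2" using m(1) by (metis add.commute le_Suc_ex)
    show ?thesis
    proof (cases "\<exists>x'\<in>A. x' \<noteq> x \<and> E w x'")
      case True
      then obtain x' where x': "x' \<in> A" "x' \<noteq> x" "E w x'" by blast
      have pair: "3 * a + 1 \<le> degree E x + degree E x'" using degree_sum wx x' by metis
      have "(\<Sum>y\<in>A - {x, x'}. 3 * a + 1) \<le> (\<Sum>y\<in>A - {x, x'}. 2 * degree E y)"
      proof (rule sum_mono)
        fix y assume "y \<in> A - {x, x'}"
        then have "y \<in> A" "y \<notin> L" using x by auto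
        then show "3 * a + 1 \<le> 2 * degree E y" unfolding L_def by simp
      qed
      moreover have "card (A - {x, x'}) = m - 2"
        using xA x' finA cA by (simp add: card_Diff_subset)
      ultimately have "(m - 2) * (3 * a + 1) \<le> 2 * (\<Sum>y\<in>A - {x, x'}. degree E y)"
        by (simp add: sum_distrib_left)
      moreover have "(\<Sum>y\<in>A. degree E y) = (\<Sum>y\<in>A - {x, x'}. degree E y) + (degree E x + degree E x')"
        using sum.subset_diff[of "{x, x'}" A "degree E"] xA x' finA by simp
      ultimately have "m * (3 * a + 1) \<le> 2 * (\<Sum>x\<in>A. degree E x)"
        using pair unfolding k by (simp add: algebra_simps)
      then show ?thesis by (rule easy)
    next
      case False
      have "(\<Sum>v\<in>A. of_bool (E w v)) = (\<Sum>v\<in>{x}. of_bool (E w v) :: nat)"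
        by (rule sum.mono_neutral_right) (use False finA xA in auto)
      then have "(\<Sum>v\<in>A. of_bool (E w v)) \<le> (1 :: nat)" by (simp del: sum_of_bool_eq)
      moreover have "arcs_between E B A = (\<Sum>v\<in>A. of_bool (E w v)) + arcs_between E (B - {w}) A"
        unfolding arcs_between_def using finB w(1) by (rule sum.remove)
      moreover have "arcs_between E (B - {w}) A \<le> (m - 1) * m"
        by (rule arcs_between_le_card_mult) (use finB finA cB cA w in auto)
      ultimately have e: "arcs_between E B A \<le> 1 + (k + 1) * m" unfolding k by simp
      have "c = k + 1" using c 2 k by simp
      then have "(k + 1) * (3 * a + 1) + 2 * (a + 1) \<le> 2 * (\<Sum>x\<in>A. degree E x)"
        using high low split 2 by (simp add: algebra_simps)
      \<comment> \<open>With the bound \<open>e\<close> inserted, the slack is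
        \<open>(m - 1) * (b + 3)\<close>.\<close>
      moreover have "4 * arcs_between E B A + 2 * (m * (a - m)) < (k + 1) * (3 * a + 1) + 2 * (a + 1)"
        using e unfolding am b k by (simp add: algebra_simps)
      ultimately show ?thesis by linarith
    qed
  next
    case 3
    then obtain k where k: "card L = k + 2" by (metis add.commute le_Suc_ex)
    \<comment> \<open>Any vertex dominates at most one element of \<open>L\<close>, besides at most
      all \<open>c\<close> elements of \<open>A - L\<close>.\<close>
    have "(\<Sum>x\<in>A. of_bool (E y x)) \<le> c + 1" for y
    proof -
      have "(\<Sum>x\<in>A. of_bool (E y x)) = (\<Sum>x\<in>A - L. of_bool (E y x)) + (\<Sum>x\<in>L. of_bool (E y x) :: nat)"
        using LA finA by (rule sum.subset_diff)
      also have "(\<Sum>x\<in>A - L. of_bool (E y x)) \<le> (\<Sum>x\<in>A - L. 1 :: nat)" by (rule sum_mono) simp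
      also have "\<dots> = c" using cAL by simp
      also have "(\<Sum>x\<in>L. of_bool (E y x) :: nat) = card {x\<in>L. E y x}"
        using finL by (simp add: Collect_conj_eq)
      finally show ?thesis using Lone[of y] by simp
    qed
    then have "arcs_between E B A \<le> (\<Sum>y\<in>B. c + 1)"
      unfolding arcs_between_def by (intro sum_mono)
    then have e: "arcs_between E B A \<le> m * (c + 1)" using cB by simp
    have "c * (3 * a + 1) + card L * (2 * a + 2) \<le> 2 * (\<Sum>x\<in>A. degree E x)"
      using high low split by (simp add: algebra_simps)
    \<comment> \<open>The slack is \<open>2 * m * (card L - 1) + c * (b - 1)\<close>, positive
      because \<open>card L\<close> is at least 2 and \<open>c < m\<close>.\<close>
    moreover have "4 * (m * (c + 1)) + 2 * (m * (a - m)) < c * (3 * a + 1) + card L * (2 * a + 2)"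
      unfolding am b unfolding c unfolding k by (simp add: algebra_simps)
    ultimately show ?thesis using e by linarith
  qed
qed

lemma sum_degree_split:
  assumes "A \<subseteq> X" "B \<subseteq> Y"
  shows "(\<Sum>x\<in>A. degree E x) =
    arcs_between E A B + arcs_between E A (Y - B) + arcs_between E B A + arcs_between E (Y - B) A"
proof -
  have "degree E x = (\<Sum>w\<in>B. of_bool (E x w)) + (\<Sum>w\<in>Y - B. of_bool (E x w)) +
      (\<Sum>w\<in>B. of_bool (E w x)) + (\<Sum>w\<in>Y - B. of_bool (E w x))" if "x \<in> A" for x
  proof -
    have "{w. E x w} = Y \<inter> {w. E x w}" "{w. E w x} = Y \<inter> {w. E w x}"
      using out_subset in_subset assms(1) that by blast+
    then have "degree E x = (\<Sum>w\<in>Y. of_bool (E x w)) + (\<Sum>w\<in>Y. of_bool (E w x))"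
      using finY by (simp add: degree_def)
    then show ?thesis
      using sum.subset_diff[OF assms(2) finY, of "\<lambda>w. of_bool (E x w) :: nat"]
        sum.subset_diff[OF assms(2) finY, of "\<lambda>w. of_bool (E w x) :: nat"] by linarith
  qed
  then have "(\<Sum>x\<in>A. degree E x) = (\<Sum>x\<in>A. (\<Sum>w\<in>B. of_bool (E x w)) + (\<Sum>w\<in>Y - B. of_bool (E x w)) +
      (\<Sum>w\<in>B. of_bool (E w x)) + (\<Sum>w\<in>Y - B. of_bool (E w x)))"
    by (rule sum.cong[OF refl])
  then show ?thesis
    unfolding sum.distrib arcs_between_swap[of E B] arcs_between_swap[of E "Y - B"]
    by (simp only: arcs_between_def)
qed

text \<open>Stated for any union \<open>C\<close> of cycles, so that it applies to an orbit as well
  as to the complement of one.\<close>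

lemma no_unmergeable_invariant_set:
  assumes f: "cycle_factor E (X \<union> Y) f"
    and inv: "\<And>v. v \<in> X \<union> Y \<Longrightarrow> f v \<in> C \<longleftrightarrow> v \<in> C"
    and unm: "\<And>u v. u \<in> X \<union> Y \<Longrightarrow> v \<in> X \<union> Y \<Longrightarrow> u \<in> C \<Longrightarrow> v \<notin> C \<Longrightarrow> \<not> (E u (f v) \<and> E v (f u))"
    and C: "c \<in> X \<union> Y" "c \<in> C" "2 * card (X \<inter> C) \<le> a"
  shows False
proof -
  interpret sw: dense_dominated_bipartite Y X E a by (rule swap_dense)
  define m where "m = card (X \<inter> C)"
  have fE: "E v (f v)" if "v \<in> X \<union> Y" for v using f that by (simp add: cycle_factor_def)
  have fXY: "bij_betw f X Y" by (rule factor_bij[OF f])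
  have fYX: "bij_betw f Y X" using sw.factor_bij f by (simp add: Un_commute)
  have restrict: "bij_betw f (P \<inter> C) (Q \<inter> C)" "bij_betw f (P - C) (Q - C)"
    if "bij_betw f P Q" "P \<subseteq> X \<union> Y" for P Q
  proof -
    have "f ` (P \<inter> C) = Q \<inter> C" "f ` (P - C) = Q - C"
      using that inv unfolding bij_betw_def by blast+
    then show "bij_betw f (P \<inter> C) (Q \<inter> C)" "bij_betw f (P - C) (Q - C)"
      using that(1) by (auto simp: bij_betw_def intro: inj_on_subset)
  qed
  note X1 = restrict(1)[OF fXY Un_upper1] and Xo = restrict(2)[OF fXY Un_upper1]
    and Y1 = restrict(1)[OF fYX Un_upper2] and Yo = restrict(2)[OF fYX Un_upper2]
  have cX: "card (X \<inter> C) = m" and cY: "card (Y \<inter> C) = m"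
    using bij_betw_same_card[OF X1] by (simp_all add: m_def)
  have cXo: "card (X - C) = a - m"
    using cX cardX finX card_Diff_subset_Int[of X C] by simp
  have cYo: "card (Y - C) = a - m"
    using cY cardY finY card_Diff_subset_Int[of Y C] by simp
  have m_le: "2 * m \<le> a" using C(3) by (simp add: m_def)
  have m_pos: "1 \<le> m"
  proof -
    have "X \<inter> C \<noteq> {} \<or> Y \<inter> C \<noteq> {}" using C(1,2) by blast
    then have "card (X \<inter> C) \<noteq> 0 \<or> card (Y \<inter> C) \<noteq> 0" using finX finY by simp
    then show ?thesis using cX cY by linarith
  qed
  have XYcross: "arcs_between E (X \<inter> C) (Y - C) + arcs_between E (X - C) (Y \<inter> C) \<le> m * (a - m)"
    using arcs_between_crossing[OF _ _ X1 Xo, of E] unm finX by (simp add: cX cXo)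
  have YXcross: "arcs_between E (Y \<inter> C) (X - C) + arcs_between E (Y - C) (X \<inter> C) \<le> m * (a - m)"
    using arcs_between_crossing[OF _ _ Y1 Yo, of E] unm finY by (simp add: cY cYo)
  have "Y - Y \<inter> C = Y - C" "X - X \<inter> C = X - C" by auto
  then have sumX: "(\<Sum>x\<in>X \<inter> C. degree E x) = arcs_between E (X \<inter> C) (Y \<inter> C)
        + arcs_between E (X \<inter> C) (Y - C) + arcs_between E (Y \<inter> C) (X \<inter> C) + arcs_between E (Y - C) (X \<inter> C)"
    and sumY: "(\<Sum>y\<in>Y \<inter> C. degree E y) = arcs_between E (Y \<inter> C) (X \<inter> C)
        + arcs_between E (Y \<inter> C) (X - C) + arcs_between E (X \<inter> C) (Y \<inter> C) + arcs_between E (X - C) (Y \<inter> C)"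
    using sum_degree_split[of "X \<inter> C" "Y \<inter> C"] sw.sum_degree_split[of "Y \<inter> C" "X \<inter> C"] by simp_all
  show False
  proof (cases "m = 1")
    case False
    then have m2: "2 \<le> m" using m_pos by linarith
    have "2 * arcs_between E (Y \<inter> C) (X \<inter> C) + m * (a - m) < (\<Sum>x\<in>X \<inter> C. degree E x)"
      by (rule sum_degree_gt[OF _ _ cX cY m2 m_le Y1]) (use fE in auto)
    moreover have "2 * arcs_between E (X \<inter> C) (Y \<inter> C) + m * (a - m) < (\<Sum>y\<in>Y \<inter> C. degree E y)"
      by (rule sw.sum_degree_gt[OF _ _ cY cX m2 m_le X1]) (use fE in auto)
    \<comment> \<open>In the sum of the two inequalities the arcs inside \<open>C\<close> cancel.
      More than \<open>2 * m * (a - m)\<close> arcs would have to cross between \<open>C\<close> and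
      its complement, against the two crossing bounds.\<close>
    ultimately show False using XYcross YXcross sumX sumY by linarith
  next
    \<comment> \<open>On a 2-cycle the counting is tight: both degrees are \<open>a + 1\<close>, which forces all other vertices
       to be adjacent in both directions to the whole opposite side.\<close>
    case True
    obtain x y where x: "X \<inter> C = {x}" and y: "Y \<inter> C = {y}"
      using cX cY True by (metis card_1_singletonE)
    have xX: "x \<in> X" "x \<in> C" and yY: "y \<in> Y" "y \<in> C" using x y by blast+
    have fx: "f x = y" and fy: "f y = x" using X1 Y1 x y by (auto simp: bij_betw_def)
    have "arcs_between E {x} {y} \<le> 1" "arcs_between E {y} {x} \<le> 1"
      by (simp_all add: arcs_between_def del: sum_of_bool_eq)
    \<comment> \<open>Each of the at most two arcs inside \<open>C\<close> counts in both degrees;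
      the crossing arcs add at most \<open>2 * (a - 1)\<close>.\<close>
    then have "degree E x + degree E y \<le> 4 + 2 * (a - 1)"
      using XYcross YXcross sumX sumY unfolding x y True by simp
    then have d: "degree E x = a + 1" "degree E y = a + 1"
      using degree_ge[of x] degree_ge[of y] xX yY a_ge by auto
    have complete: "2 * a \<le> degree E v'"
      if "v = x \<or> v = y" "3 * a + 1 \<le> degree E v + degree E v'" for v v'
      using that d by auto
    obtain w p where p: "E w x" "E w p" "3 * a + 1 \<le> degree E x + degree E p"
      using ex_partner[of x] xX by blast
    obtain w' q where q: "E w' y" "E w' q" "3 * a + 1 \<le> degree E y + degree E q"
      using ex_partner[of y] yY by blast
    have "p \<in> X" "q \<in> Y" using p q sides xX yY disj by blast+
    \<comment> \<open>The partners \<open>p\<close> and \<open>q\<close> have full degree, so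
      \<open>q\<close> dominates all of \<open>X\<close> and \<open>p\<close> all of
      \<open>Y\<close>. Hence \<open>x\<close> forms a dominated pair with every other vertex of
      \<open>X\<close>, and \<open>y\<close> with every other vertex of \<open>Y\<close>.\<close>
    have qX: "E q v" if "v \<in> X" for v
      using sw.full_degree_adjacent(1)[OF \<open>q \<in> Y\<close> _ that] complete q by blast
    have pY: "E p v" if "v \<in> Y" for v
      using full_degree_adjacent(1)[OF \<open>p \<in> X\<close> _ that] complete p by blast
    have fullX: "2 * a \<le> degree E v" if "v \<in> X" "v \<noteq> x" for v
      using degree_sum[OF qX qX, of x v] complete xX that by blast
    have fullY: "2 * a \<le> degree E v" if "v \<in> Y" "v \<noteq> y" for v
      using degree_sum[OF pY pY, of y v] complete yY that by blast
    have "card (X - C) \<noteq> 0" using cXo True a_ge by simp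
    then obtain z where z: "z \<in> X" "z \<notin> C" by (metis DiffE card.empty ex_in_conv)
    have fz: "f z \<in> Y" "f z \<notin> C" using fXY inv z by (auto simp: bij_betw_def)
    \<comment> \<open>The two arcs needed to exchange the images \<open>f x = y\<close> and
      \<open>f z\<close>, which would merge the cycles.\<close>
    have "E z y" using full_degree_adjacent(1)[OF z(1) fullX] z xX yY by blast
    moreover have "E x (f z)" using sw.full_degree_adjacent(2)[OF fz(1) fullY] fz xX yY by blast
    ultimately show False using unm[of x z] z xX fx by simp
  qed
qed

text \<open>If an orbit of an unmergeable factor missed a vertex, the orbit or its complement would
  contain at most half of \<open>X\<close>, and \<open>no_unmergeable_invariant_set\<close> would
  apply to it.\<close>

lemma ex_single_orbit_factor:
  "\<exists>f. cycle_factor E (X \<union> Y) f \<and> (\<forall>u\<in>X \<union> Y. \<forall>v\<in>X \<union> Y. v \<in> orbit f u)"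
proof -
  obtain f0 where "cycle_factor E (X \<union> Y) f0" using ex_cycle_factor by blast
  then obtain f where f: "cycle_factor E (X \<union> Y) f"
    and unm: "\<And>u v. u \<in> X \<union> Y \<Longrightarrow> v \<in> X \<union> Y \<Longrightarrow> v \<notin> orbit f u \<Longrightarrow> \<not> (E u (f v) \<and> E v (f u))"
    using cycle_factor_unmergeable[OF finV] by blast
  have perm: "f permutes (X \<union> Y)" using f by (simp add: cycle_factor_def)
  then have self: "v \<in> orbit f v" for v
    using finV permutation_permutes permutation_self_in_orbit by metis
  have "v \<in> orbit f u" if uv: "u \<in> X \<union> Y" "v \<in> X \<union> Y" for u v
  proof (rule ccontr)
    assume v: "v \<notin> orbit f u"
    define C where "C = orbit f u"
    have inv: "f t \<in> C \<longleftrightarrow> t \<in> C" for t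
    proof
      assume "f t \<in> C"
      moreover have "t \<in> orbit f (f t)" using orbit_swap[OF self orbit.base] .
      ultimately show "t \<in> C" unfolding C_def by (rule orbit_trans[rotated])
    qed (auto simp: C_def intro: orbit.step)
    have C_unm: "\<not> (E s (f t) \<and> E t (f s))" if "s \<in> X \<union> Y" "t \<in> X \<union> Y" "s \<in> C" "t \<notin> C" for s t
    proof (rule unm[OF that(1,2)])
      show "t \<notin> orbit f s" using that(3,4) unfolding C_def by (meson orbit_trans)
    qed
    have "card (X \<inter> C) + card (X \<inter> - C) = a"
      using cardX card_Int_Diff[OF finX] by (metis Diff_eq)
    then consider "2 * card (X \<inter> C) \<le> a" | "2 * card (X \<inter> - C) \<le> a" by linarith
    then show False
    proof cases
      case 1
      show False
        by (rule no_unmergeable_invariant_set[OF f inv C_unm uv(1) _ 1]) (simp_all add: C_def self)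
    next
      case 2
      show False
        by (rule no_unmergeable_invariant_set[OF f _ _ uv(2) _ 2])
          (use inv C_unm v in \<open>auto simp: C_def\<close>)
    qed
  qed
  then show ?thesis using f by blast
qed

end

lemma (in dominated_bipartite) ex_spanning_cycle:
  "\<exists>f. cycle_factor E (X \<union> Y) f \<and> (\<forall>u\<in>X \<union> Y. \<forall>v\<in>X \<union> Y. v \<in> orbit f u)"
proof (cases "\<exists>v\<in>X \<union> Y. lonely v")
  case False
  then interpret dense_dominated_bipartite X Y E a by unfold_locales blast
  show ?thesis by (rule ex_single_orbit_factor)
qed (use lonely_factor in blast)

section \<open>Hamiltonian cycles of digraphs\<close>

text \<open>\<open>cas\<close> and \<open>awalk_verts\<close> consume a walk from the front, so both
  claims are proved for all suffixes \<open>[i..<n]\<close>, by induction on \<open>i\<close>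
  downwards from \<open>n\<close>.\<close>

lemma (in pre_digraph) awalk_map_funpow:
  assumes "\<And>i. i < n \<Longrightarrow> e i \<in> arcs G \<and> tail G (e i) = s i \<and> head G (e i) = s (Suc i)"
    and "s 0 \<in> verts G"
  shows "awalk (s 0) (map e [0..<n]) (s n)"
    and "awalk_verts (s 0) (map e [0..<n]) = map s [0..<Suc n]"
proof -
  have cas: "cas (s i) (map e [i..<n]) (s n)" if "i \<le> n" for i
    using that
  proof (induction rule: inc_induct)
    case (step i)
    then show ?case using assms(1)[of i] by (simp add: upt_conv_Cons)
  qed simp
  then have c: "cas (s 0) (map e [0..<n]) (s n)" by simp
  then show "awalk (s 0) (map e [0..<n]) (s n)" using assms by (auto simp: awalk_def)
  have "awalk_verts (s i) (map e [i..<n]) = map s [i..<Suc n]" if "i \<le> n" for i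
    using that
  proof (induction rule: inc_induct)
    case (step i)
    then show ?case using assms(1)[of i] by (simp add: upt_conv_Cons)
  qed simp
  then show "awalk_verts (s 0) (map e [0..<n]) = map s [0..<Suc n]" by simp
qed

lemma hamiltonian_if_single_orbit:
  assumes "finite (verts D)" "u \<in> verts D"
    and f: "cycle_factor (dominates D) (verts D) f"
    and orb: "\<And>v. v \<in> verts D \<Longrightarrow> v \<in> orbit f u"
  shows "hamiltonian D"
proof -
  have perm: "f permutes (verts D)" using f by (simp add: cycle_factor_def)
  then have self: "u \<in> orbit f u"
    using assms(1) permutation_permutes permutation_self_in_orbit by metis
  \<comment> \<open>The length of the cycle through \<open>u\<close>: the least positive number of
    iterations that returns to \<open>u\<close>.\<close>
  define n where "n = funpow_dist1 f u u"
  define s where "s i = (f ^^ i) u" for i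
  have sn: "s n = u" unfolding s_def n_def by (rule funpow_dist1_prop[OF self])
  have s0: "s 0 = u" by (simp add: s_def)
  have sV: "s i \<in> verts D" for i
    by (induction i) (use assms(2) perm in \<open>simp_all add: s_def permutes_in_image\<close>)
  have "\<exists>e. e \<in> arcs D \<and> tail D e = s i \<and> head D e = s (Suc i)" for i
  proof -
    have "(s i, s (Suc i)) \<in> arcs_ends D" using f sV[of i] by (simp add: cycle_factor_def s_def)
    then show ?thesis by (auto simp: arcs_ends_conv)
  qed
  then obtain e where e: "\<And>i. e i \<in> arcs D \<and> tail D (e i) = s i \<and> head D (e i) = s (Suc i)"
    by metis
  let ?p = "map e [0..<n]"
  have walk: "pre_digraph.awalk D u ?p u"
    and wv: "pre_digraph.awalk_verts D u ?p = map s [0..<Suc n]"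
    using pre_digraph.awalk_map_funpow[of n e D s] e sV s0 sn by auto
  have inj: "inj_on s {0..<n}"
    unfolding s_def n_def by (rule inj_on_funpow_dist1[OF self])
  \<comment> \<open>The closed walk lists \<open>u\<close> at both ends, so only its tail is
    distinct; the tail is the image under \<open>f\<close> of the first \<open>n\<close>
    iterates.\<close>
  have "tl (map s [0..<Suc n]) = map (f \<circ> s) [0..<n]"
    by (simp add: upt_rec[of 0 "Suc n"] map_Suc_upt[symmetric] s_def comp_def del: upt_Suc)
  moreover have "inj_on (f \<circ> s) {0..<n}"
    using inj permutes_inj[OF perm] by (simp add: comp_inj_on inj_on_subset)
  ultimately have "distinct (tl (pre_digraph.awalk_verts D u ?p))"
    unfolding wv by (simp add: distinct_map)
  moreover have "?p \<noteq> []" by (simp add: n_def)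
  ultimately have "pre_digraph.cycle D ?p"
    using walk unfolding pre_digraph.cycle_def by blast
  moreover have "set (pre_digraph.awalk_verts D u ?p) = verts D"
  proof
    show "set (pre_digraph.awalk_verts D u ?p) \<subseteq> verts D" unfolding wv using sV by auto
    have "orbit f u = (\<lambda>i. (f ^^ i) u) ` {0..<n}"
      unfolding n_def by (rule orbit_conv_funpow_dist1[OF self])
    then have "orbit f u \<subseteq> set (map s [0..<Suc n])" unfolding s_def by auto
    then show "verts D \<subseteq> set (pre_digraph.awalk_verts D u ?p)" unfolding wv using orb by blast
  qed
  ultimately show ?thesis using walk unfolding hamiltonian_def by blast
qed

text \<open>Without multiple arcs, an arc leaving or entering \<open>v\<close> is determined by its
  other end.\<close>

lemma (in digraph) total_degree_eq: "total_degree G v = degree (dominates G) v"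
proof -
  have "bij_betw (head G) (out_arcs G v) {w. v \<rightarrow>\<^bsub>G\<^esub> w}"
  proof (rule bij_betw_imageI)
    show "inj_on (head G) (out_arcs G v)"
      by (rule inj_onI) (auto intro: no_multi_arcs simp: arc_to_ends_def)
  qed (auto simp: arcs_ends_conv)
  moreover have "bij_betw (tail G) (in_arcs G v) {w. w \<rightarrow>\<^bsub>G\<^esub> v}"
  proof (rule bij_betw_imageI)
    show "inj_on (tail G) (in_arcs G v)"
      by (rule inj_onI) (auto intro: no_multi_arcs simp: arc_to_ends_def)
  qed (auto simp: arcs_ends_conv)
  ultimately show ?thesis
    unfolding total_degree_def degree_def out_degree_def in_degree_def
    by (simp add: bij_betw_same_card)
qed

theorem theorem5p2:
  fixes D :: "('a, 'b) pre_digraph" and a :: nat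
  assumes "digraph D"
    and "strongly_connected D"
    and "balanced_bipartite D"
    and "card (verts D) = 2 * a"
    and "a \<ge> 2"
    and "\<And>u v. dominated_pair D u v \<Longrightarrow> total_degree D u + total_degree D v \<ge> 3 * a + 1"
  shows "hamiltonian D"
proof -
  interpret digraph D by (rule assms(1))
  obtain X Y where XY: "bipartition D X Y" "card X = card Y"
    using assms(3) by (auto simp: balanced_bipartite_def)
  have V: "X \<union> Y = verts D" and disj: "X \<inter> Y = {}" using XY(1) by (auto simp: bipartition_def)
  have fin: "finite X" "finite Y" using V finite_verts by (metis finite_Un)+
  have "card X + card Y = 2 * a"
    using card_Un_disjoint[OF fin disj] assms(4) by (simp add: V)
  then have card: "card X = a" "card Y = a" using XY(2) by simp_all
  interpret dominated_bipartite X Y "dominates D" a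
  proof
    show "u \<in> X \<and> v \<in> Y \<or> u \<in> Y \<and> v \<in> X" if "u \<rightarrow>\<^bsub>D\<^esub> v" for u v
      using that XY(1) by (auto simp: bipartition_def arcs_ends_conv)
    show "(dominates D)\<^sup>*\<^sup>* u v" if "u \<in> X \<union> Y" "v \<in> X \<union> Y" for u v
    proof -
      have "u \<rightarrow>\<^sup>*\<^bsub>D\<^esub> v" using assms(2) that by (auto simp: V strongly_connected_def)
      then have "(u, v) \<in> (arcs_ends D)\<^sup>*" by (rule reachable_rtranclI)
      then show ?thesis by (simp add: rtranclp_rtrancl_eq)
    qed
    show "3 * a + 1 \<le> degree (dominates D) u + degree (dominates D) v"
      if "w \<rightarrow>\<^bsub>D\<^esub> u" "w \<rightarrow>\<^bsub>D\<^esub> v" "u \<noteq> v" for w u v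
    proof -
      have "dominated_pair D u v" using that adj_in_verts by (auto simp: dominated_pair_def)
      then show ?thesis using assms(6) by (simp add: total_degree_eq)
    qed
  qed (fact fin disj card assms(5))+
  obtain f where f: "cycle_factor (dominates D) (verts D) f"
    and orb: "\<forall>u\<in>verts D. \<forall>v\<in>verts D. v \<in> orbit f u"
    using ex_spanning_cycle unfolding V by blast
  obtain u where "u \<in> verts D" using assms(2) by (auto simp: strongly_connected_def)
  then show ?thesis using hamiltonian_if_single_orbit[OF finite_verts _ f] orb by blast
qed

end
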